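(* Let $K$ be a number field of degree $n$ over $\mathbb{Q}$ and let $O$ be an order of $K$. Let $O_n=\{\alpha\in O\mid \mathbb{Q}(\alpha)=K\}$. Then $\mathrm{Int}(O_n,O)=\mathrm{Int}(O)$, that is, $O_n$ is polynomially dense in $O$.
   Context: An order of a number field $K$ is a subring of $K$ contained in the ring of integers $O_K$ which has maximal rank $[K:\mathbb{Q}]$ as a $\mathbb{Z}$-module. $\mathrm{Int}(O_n,O)=\{f\in K[X]\mid f(O_n)\subset O\}$ and $\mathrm{Int}(O)=\{f\in K[X]\mid f(O)\subset O\}$. A subset $S$ of a domain $D$ with quotient field $K$ is polynomially dense in $D$ if $\{f\in K[X]\mid f(S)\subset D\}=\{f\in K[X]\mid f(D)\subset D\}$. *)

theory Defs
  imports "HOL-Computational_Algebra.Polynomial"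
begin

global_interpretation rat_vs: vector_space "\<lambda>(q::rat) (x::'a::field_char_0). of_rat q * x"
  by unfold_locales (simp_all add: algebra_simps of_rat_add of_rat_mult)

global_interpretation int_mod: module "\<lambda>(k::int) (x::'a::comm_ring_1). of_int k * x"
  by unfold_locales (simp_all add: algebra_simps)

text \<open>
  A number field is modelled as a type \<open>'a\<close>, so that \<open>K = UNIV :: 'a set\<close> and
  \<open>K[X]\<close> is the type \<open>'a poly\<close>.
\<close>

definition number_field :: "'a::field_char_0 itself \<Rightarrow> bool" where
  "number_field _ \<longleftrightarrow> (\<exists>B::'a set. finite B \<and> rat_vs.span B = UNIV)"

definition field_degree :: "'a::field_char_0 itself \<Rightarrow> nat" where
  "field_degree _ = rat_vs.dim (UNIV :: 'a set)"

definition is_subring :: "'a::comm_ring_1 set \<Rightarrow> bool" where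
  "is_subring R \<longleftrightarrow> 1 \<in> R \<and> (\<forall>x\<in>R. \<forall>y\<in>R. x - y \<in> R \<and> x * y \<in> R)"

definition is_subfield :: "'a::field set \<Rightarrow> bool" where
  "is_subfield F \<longleftrightarrow> is_subring F \<and> (\<forall>x\<in>F. x \<noteq> 0 \<longrightarrow> inverse x \<in> F)"

text \<open>The prime field of a field of characteristic zero is \<open>\<rat>\<close>, so the least subfield
  containing \<open>\<alpha>\<close> is \<open>\<rat>(\<alpha>)\<close>.\<close>

definition rat_adjoin :: "'a::field_char_0 \<Rightarrow> 'a set" where
  "rat_adjoin \<alpha> = \<Inter> {F. is_subfield F \<and> \<alpha> \<in> F}"

definition ring_of_integers :: "'a::field_char_0 set" where
  "ring_of_integers = {x. algebraic_int x}"

text \<open>The rank of a \<open>\<int>\<close>-submodule \<open>M\<close> is the largest size of a \<open>\<int>\<close>-linearly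
  independent subset of \<open>M\<close>.\<close>

definition has_int_rank :: "'a::comm_ring_1 set \<Rightarrow> nat \<Rightarrow> bool" where
  "has_int_rank M r \<longleftrightarrow>
     (\<exists>B\<subseteq>M. int_mod.independent B \<and> finite B \<and> card B = r) \<and>
     (\<forall>B\<subseteq>M. int_mod.independent B \<longrightarrow> finite B \<and> card B \<le> r)"

definition is_order :: "'a::field_char_0 set \<Rightarrow> bool" where
  "is_order R \<longleftrightarrow> is_subring R \<and> R \<subseteq> ring_of_integers \<and> has_int_rank R (field_degree TYPE('a))"

definition field_generators :: "'a::field_char_0 set \<Rightarrow> 'a set" where
  "field_generators R = {\<alpha> \<in> R. rat_adjoin \<alpha> = UNIV}"

text \<open>\<open>Int(S, D)\<close>; the ring of integer-valued polynomials \<open>Int(D)\<close> is \<open>Int(D, D)\<close>.\<close>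

definition int_valued_on :: "'a::field set \<Rightarrow> 'a set \<Rightarrow> 'a poly set" where
  "int_valued_on S D = {f. poly f ` S \<subseteq> D}"

abbreviation int_valued :: "'a::field set \<Rightarrow> 'a poly set" where
  "int_valued D \<equiv> int_valued_on D D"

definition has_quotient_field_UNIV :: "'a::field set \<Rightarrow> bool" where
  "has_quotient_field_UNIV D \<longleftrightarrow>
     is_subring D \<and> (\<forall>x. \<exists>a\<in>D. \<exists>b\<in>D. b \<noteq> 0 \<and> x = a / b)"

definition polynomially_dense :: "'a::field set \<Rightarrow> 'a set \<Rightarrow> bool" where
  "polynomially_dense S D \<longleftrightarrow>
     has_quotient_field_UNIV D \<and> S \<subseteq> D \<and> int_valued_on S D = int_valued D"

end

theory Submission
  imports "HOL-Algebra.Algebraic_Closure_Type" Defs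
begin

text \<open>
  If \<open>d > 0\<close> is an integer with \<open>d f \<in> O[X]\<close>, then \<open>\<alpha> \<equiv> \<beta>\<close> modulo \<open>d O\<close> implies
  \<open>f(\<alpha>) - f(\<beta>) \<in> O\<close>. So it suffices to find, in every residue class \<open>\<alpha> + d O\<close>, a generator of
  the field. Such a generator comes from the classical proof of the primitive element theorem:
  for all but finitely many integers \<open>k\<close>, the field generated by \<open>\<beta> + k d b\<close> contains \<open>\<beta>\<close> and
  \<open>b\<close>, and one adds in this way to \<open>\<alpha>\<close> multiples of all elements of a rational basis of the field
  that is contained in \<open>O\<close>.
\<close>

subsection \<open>Subrings and polynomials over them\<close>

lemma subring_one: "is_subring R \<Longrightarrow> 1 \<in> R"
  and subring_diff: "is_subring R \<Longrightarrow> x \<in> R \<Longrightarrow> y \<in> R \<Longrightarrow> x - y \<in> R"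
  and subring_mult: "is_subring R \<Longrightarrow> x \<in> R \<Longrightarrow> y \<in> R \<Longrightarrow> x * y \<in> R"
  by (auto simp: is_subring_def)

lemma subring_zero: "is_subring R \<Longrightarrow> 0 \<in> R"
  using subring_diff[of R 1 1] by (simp add: subring_one)

lemma subring_uminus: "is_subring R \<Longrightarrow> x \<in> R \<Longrightarrow> - x \<in> R"
  using subring_diff[of R 0 x] by (simp add: subring_zero)

lemma subring_add: "is_subring R \<Longrightarrow> x \<in> R \<Longrightarrow> y \<in> R \<Longrightarrow> x + y \<in> R"
  using subring_diff[of R x "- y"] by (simp add: subring_uminus)

lemma subring_of_nat: "is_subring R \<Longrightarrow> of_nat k \<in> R"
  by (induction k) (auto intro: subring_zero subring_add subring_one)

lemma subring_of_int: "is_subring R \<Longrightarrow> of_int k \<in> R"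
  by (cases k rule: int_cases2) (auto intro: subring_of_nat subring_uminus)

lemma subring_sum: "is_subring R \<Longrightarrow> (\<And>i. i \<in> A \<Longrightarrow> f i \<in> R) \<Longrightarrow> sum f A \<in> R"
  by (induction A rule: infinite_finite_induct) (auto intro: subring_zero subring_add)

lemma subfield_subring: "is_subfield F \<Longrightarrow> is_subring F"
  by (simp add: is_subfield_def)

lemma subfield_divide: "is_subfield F \<Longrightarrow> x \<in> F \<Longrightarrow> y \<in> F \<Longrightarrow> x / y \<in> F"
  unfolding is_subfield_def divide_inverse
  \<comment> \<open>For \<open>y = 0\<close> the default value \<open>inverse 0 = 0\<close> is
    \<open>y\<close> itself, so it lies in \<open>F\<close> as well.\<close>
  by (metis inverse_zero subring_mult)

lemma subfield_of_rat:
  fixes F :: "'a::field_char_0 set"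
  assumes "is_subfield F"
  shows "of_rat q \<in> F"
proof (cases q)
  case (Fract a b)
  then show ?thesis
    using subfield_divide[OF assms subring_of_int subring_of_int] subfield_subring[OF assms]
    by (simp add: of_rat_rat)
qed

text \<open>For a subring \<open>R\<close> this is R[X], kept as a subset of K[X]. Divisibility and
  roots of its members are therefore always taken over K.\<close>

definition polys_over :: "'a::comm_ring_1 set \<Rightarrow> 'a poly set" where
  "polys_over R = {p. \<forall>i. Polynomial.coeff p i \<in> R}"

lemma polys_over_coeff: "p \<in> polys_over R \<Longrightarrow> Polynomial.coeff p i \<in> R"
  by (simp add: polys_over_def)

lemma polys_over_pCons:
  "pCons a p \<in> polys_over R \<longleftrightarrow> a \<in> R \<and> p \<in> polys_over R"
  unfolding polys_over_def mem_Collect_eq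
  by (metis coeff_pCons_0 coeff_pCons_Suc old.nat.exhaust)

lemma polys_over_0: "is_subring R \<Longrightarrow> 0 \<in> polys_over R"
  by (simp add: polys_over_def subring_zero)

lemma polys_over_add:
  "is_subring R \<Longrightarrow> p \<in> polys_over R \<Longrightarrow> q \<in> polys_over R \<Longrightarrow> p + q \<in> polys_over R"
  by (simp add: polys_over_def subring_add)

lemma polys_over_diff:
  "is_subring R \<Longrightarrow> p \<in> polys_over R \<Longrightarrow> q \<in> polys_over R \<Longrightarrow> p - q \<in> polys_over R"
  by (simp add: polys_over_def subring_diff)

lemma polys_over_mult:
  "is_subring R \<Longrightarrow> p \<in> polys_over R \<Longrightarrow> q \<in> polys_over R \<Longrightarrow> p * q \<in> polys_over R"
  by (simp add: polys_over_def coeff_mult subring_sum subring_mult)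

lemma polys_over_monom: "is_subring R \<Longrightarrow> c \<in> R \<Longrightarrow> Polynomial.monom c k \<in> polys_over R"
  by (simp add: polys_over_def subring_zero)

lemma polys_over_pcompose:
  assumes "is_subring R" "q \<in> polys_over R"
  shows "p \<in> polys_over R \<Longrightarrow> pcompose p q \<in> polys_over R"
  by (induction p)
     (auto simp: pcompose_pCons polys_over_pCons polys_over_0 assms
        intro!: polys_over_add polys_over_mult)

lemma poly_polys_over_mem:
  assumes "is_subring R" "x \<in> R"
  shows "p \<in> polys_over R \<Longrightarrow> poly p x \<in> R"
  by (induction p) (auto simp: polys_over_pCons assms subring_zero subring_add subring_mult)

text \<open>Induction along Horner's scheme: for p = a + X g, the difference p(x) - p(y) equals x
  (g(x) - g(y)) + (x - y) g(y). What matters is that the cofactor \<open>r\<close> stays in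
  \<open>R\<close>, so that a congruence between arguments passes to the values.\<close>

lemma poly_diff_factor:
  assumes R: "is_subring R" "x \<in> R" "y \<in> R"
  shows "p \<in> polys_over R \<Longrightarrow> \<exists>r\<in>R. poly p x - poly p y = (x - y) * r"
proof (induction p)
  case 0
  show ?case
    using subring_zero[OF R(1)] by (intro bexI[of _ 0]) auto
next
  case (pCons a p)
  then obtain r where r: "r \<in> R" "poly p x - poly p y = (x - y) * r" and p: "p \<in> polys_over R"
    by (auto simp: polys_over_pCons)
  have "poly (pCons a p) x - poly (pCons a p) y = x * (poly p x - poly p y) + (x - y) * poly p y"
    by (simp add: algebra_simps)
  also have "\<dots> = (x - y) * (x * r + poly p y)"
    by (simp add: r(2) algebra_simps)
  finally show ?case
    using r(1) p R by (intro bexI[of _ "x * r + poly p y"])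
      (auto intro: subring_add subring_mult poly_polys_over_mem)
qed

text \<open>A nonzero polynomial of least degree in F[X] vanishing at \<open>x\<close> serves as
  \<open>m\<close>. Leading terms are cancelled one at a time, with coefficients in
  \<open>F\<close>, so that each remainder is again in F[X] and the minimality of \<open>m\<close>
  applies to it.\<close>

lemma minimal_polynomial_over_subfield:
  assumes F: "is_subfield F"
    and p: "p \<in> polys_over F" "p \<noteq> 0" "poly p x = 0"
  obtains m where "m \<in> polys_over F" "m \<noteq> 0" "poly m x = 0"
    and "\<And>g. g \<in> polys_over F \<Longrightarrow> poly g x = 0 \<Longrightarrow> m dvd g"
proof -
  note FR = subfield_subring[OF F]
  let ?P = "\<lambda>m. m \<in> polys_over F \<and> m \<noteq> 0 \<and> poly m x = 0"
  obtain m where m: "?P m" and min: "\<And>g. ?P g \<Longrightarrow> Polynomial.degree m \<le> Polynomial.degree g"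
    using p arg_min_nat_lemma[of ?P p Polynomial.degree] by blast
  have "m dvd g" if "g \<in> polys_over F" "poly g x = 0" for g
    using that
  proof (induction "Polynomial.degree g" arbitrary: g rule: less_induct)
    case less
    show ?case
    proof (cases "g = 0")
      case False
      \<comment> \<open>The multiple \<open>s\<close> of \<open>m\<close> has the same degree and
        leading coefficient as \<open>g\<close>, so \<open>g - s\<close> is zero or has smaller
        degree, and it still vanishes at \<open>x\<close>.\<close>
      define c where "c = lead_coeff g / lead_coeff m"
      define s where "s = Polynomial.monom c (Polynomial.degree g - Polynomial.degree m) * m"
      have deg: "Polynomial.degree m \<le> Polynomial.degree g"
        using min less.prems False by blast
      have c: "c \<in> F" "c \<noteq> 0"
        unfolding c_def using False m less.prems
        by (auto intro!: subfield_divide[OF F] polys_over_coeff)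
      have s: "s \<in> polys_over F" "poly s x = 0"
        using c m by (auto simp: s_def intro!: polys_over_mult polys_over_monom FR)
      have deg_s: "Polynomial.degree s = Polynomial.degree g"
        unfolding s_def using c m deg by (subst degree_mult_eq) (auto simp: degree_monom_eq)
      have "lead_coeff s = c * lead_coeff m"
        unfolding s_def by (simp only: lead_coeff_mult lead_coeff_monom)
      also have "\<dots> = lead_coeff g"
        using m by (simp add: c_def)
      finally have "lead_coeff s = lead_coeff g" .
      then have coeff_s: "Polynomial.coeff (g - s) (Polynomial.degree g) = 0"
        using deg_s by simp
      have "m dvd g - s"
      proof (cases "g - s = 0")
        case nz: False
        have "Polynomial.degree (g - s) \<le> Polynomial.degree g"
          using degree_diff_le_max[of g s] deg_s by simp
        moreover have "Polynomial.degree (g - s) \<noteq> Polynomial.degree g"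
          using coeff_s nz by (metis leading_coeff_0_iff)
        ultimately show ?thesis
          using less s FR by (intro less.hyps) (auto intro: polys_over_diff)
      qed auto
      then show ?thesis
        using dvd_add[of m "g - s" s] by (simp add: s_def)
    qed auto
  qed
  with m show thesis
    using that by blast
qed

subsection \<open>Primitive elements\<close>

lemma map_poly_to_ac_add:
  "map_poly to_ac (p + q) = map_poly to_ac p + map_poly to_ac q"
  by (rule poly_eqI) (simp add: coeff_map_poly)

lemma map_poly_to_ac_mult:
  "map_poly to_ac (p * q) = map_poly to_ac p * map_poly to_ac q"
  by (rule poly_eqI) (simp add: coeff_map_poly coeff_mult to_ac_sum)

lemma poly_map_poly_to_ac: "poly (map_poly to_ac p) (to_ac x) = to_ac (poly p x)"
  by (induction p) (simp_all add: map_poly_pCons)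

lemma map_poly_to_ac_pcompose:
  "map_poly to_ac (pcompose p q) = pcompose (map_poly to_ac p) (map_poly to_ac q)"
  by (induction p)
     (simp_all add: pcompose_pCons map_poly_pCons map_poly_to_ac_add map_poly_to_ac_mult)

lemma map_poly_to_ac_dvd_root:
  assumes "m dvd p" "poly (map_poly to_ac m) z = 0"
  shows "poly (map_poly to_ac p) z = 0"
  using assms by (auto simp: map_poly_to_ac_mult elim!: dvdE)

text \<open>After the full power of X - x is split off, the cofactor \<open>q\<close> does not
  vanish at \<open>x\<close>. A nonconstant \<open>q\<close> would have a root in the algebraic
  closure, which would be a root of \<open>m\<close> other than \<open>x\<close>.\<close>

lemma unique_root_imp_linear_power:
  fixes m :: "'a::field poly"
  assumes "m \<noteq> 0" "poly m x = 0"
    and uniq: "\<And>z. poly (map_poly to_ac m) z = 0 \<Longrightarrow> z = to_ac x"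
  obtains c r where "c \<noteq> 0" "r > 0" "m = Polynomial.smult c ([:-x, 1:] ^ r)"
proof -
  define r where "r = Polynomial.order x m"
  obtain q where q: "m = [:-x, 1:] ^ r * q" "\<not> [:-x, 1:] dvd q"
    using order_decomp[OF assms(1)] unfolding r_def by blast
  have "Polynomial.degree q = 0"
  proof (rule ccontr)
    assume "Polynomial.degree q \<noteq> 0"
    then have "Polynomial.degree (map_poly to_ac q) > 0"
      by (simp add: degree_map_poly)
    then obtain z where z: "poly (map_poly to_ac q) z = 0"
      using alg_closed_imp_poly_has_root by blast
    have "q dvd m"
      by (simp add: q(1))
    then have "z = to_ac x"
      using uniq map_poly_to_ac_dvd_root z by blast
    then have "poly q x = 0"
      using z by (simp add: poly_map_poly_to_ac)
    with q(2) show False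
      by (simp add: poly_eq_0_iff_dvd)
  qed
  then obtain c where c: "q = [:c:]"
    by (rule degree_eq_zeroE)
  have "r > 0"
    using assms(1,2) order_root[of m x] by (simp add: r_def)
  moreover have "c \<noteq> 0"
    using c q(2) by auto
  ultimately show thesis
    using that[of c r] q(1) c by simp
qed

text \<open>In characteristic zero, the second highest coefficient of \<open>(X - x)^r\<close> determines \<open>x\<close>.\<close>

lemma linear_power_root_mem_subfield:
  fixes x :: "'a::field_char_0"
  assumes F: "is_subfield F" and "c \<noteq> 0" "r > 0"
    and m: "Polynomial.smult c ([:-x, 1:] ^ r) \<in> polys_over F"
  shows "x \<in> F"
proof -
  note FR = subfield_subring[OF F]
  obtain k where k: "r = Suc k"
    using \<open>r > 0\<close> gr0_conv_Suc by blast
  have "c \<in> F"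
    using polys_over_coeff[OF m, of r] by (simp add: coeff_linear_power)
  moreover have "Polynomial.coeff ([:-x, 1:] ^ r) k = - (of_nat r * x)"
    by (subst coeff_linear_poly_power) (simp_all add: k)
  then have "- (c * of_nat r * x) \<in> F"
    using polys_over_coeff[OF m, of k] by (simp add: mult.assoc)
  ultimately have "- (c * of_nat r * x) / (- (c * of_nat r)) \<in> F"
    by (intro subfield_divide[OF F]) (auto intro: subring_uminus subring_mult subring_of_nat FR)
  also have "- (c * of_nat r * x) / (- (c * of_nat r)) = x"
    using \<open>c \<noteq> 0\<close> \<open>r > 0\<close> by simp
  finally show ?thesis .
qed

text \<open>The integer coefficients of \<open>p\<close> lie in every subring. One \<open>p\<close>
  therefore works for all \<open>F\<close> at once, which keeps the exceptional set of the next
  lemma independent of \<open>F\<close>.\<close>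

lemma algebraic_int_polyE:
  fixes x :: "'a::field_char_0"
  assumes "algebraic_int x"
  obtains p where "p \<noteq> 0" "poly p x = 0" "\<And>F. is_subring F \<Longrightarrow> p \<in> polys_over F"
proof -
  obtain p :: "'a poly" where p: "lead_coeff p = 1" "\<forall>i. Polynomial.coeff p i \<in> \<int>" "poly p x = 0"
    using assms by (auto elim: algebraic_int.cases)
  have "Polynomial.coeff p i \<in> F" if F: "is_subring F" for F i
  proof -
    from p(2) have "Polynomial.coeff p i \<in> \<int>" ..
    then obtain k where "Polynomial.coeff p i = of_int k"
      by (rule Ints_cases)
    then show ?thesis
      by (simp add: subring_of_int[OF F])
  qed
  then have "p \<in> polys_over F" if "is_subring F" for F
    using that by (simp add: polys_over_def)
  moreover have "p \<noteq> 0"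
    using p(1) by auto
  ultimately show thesis
    using that p(3) by blast
qed

text \<open>This is the core of the primitive element theorem. If \<open>c\<close> and \<alpha> + c
  \<theta> lie in \<open>F\<close>, then the minimal polynomial of \<theta> over \<open>F\<close>
  divides two polynomials whose only common root is \<theta>, unless \<open>c\<close> belongs to a
  finite set. Hence it is a constant times a power of X - \<theta>, and its coefficients force
  \<theta> into \<open>F\<close>.\<close>

lemma finite_nonprimitive_combinations:
  fixes \<alpha> \<theta> :: "'a::field_char_0"
  assumes "algebraic_int \<alpha>" "algebraic_int \<theta>"
  shows "finite {c. \<exists>F. is_subfield F \<and> c \<in> F \<and> \<alpha> + c * \<theta> \<in> F \<and> \<not> (\<alpha> \<in> F \<and> \<theta> \<in> F)}"
    (is "finite ?Bad")
proof -
  obtain p where p: "p \<noteq> 0" "poly p \<alpha> = 0" "\<And>F. is_subring F \<Longrightarrow> p \<in> polys_over F"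
    using algebraic_int_polyE[OF assms(1)] by blast
  obtain q where q: "q \<noteq> 0" "poly q \<theta> = 0" "\<And>F. is_subring F \<Longrightarrow> q \<in> polys_over F"
    using algebraic_int_polyE[OF assms(2)] by blast
  \<comment> \<open>These are the solutions \<open>c\<close> of \<alpha> + c \<theta> = y + c z for
    roots \<open>y\<close> of \<open>p\<close> and \<open>z\<close> \<noteq> \<theta> of
    \<open>q\<close> in the algebraic closure. Pairs with \<open>z\<close> = \<theta> only
    contribute 0, by division by zero, so \<open>E\<close> stays finite.\<close>
  define E where "E = (\<lambda>(y, z). (y - to_ac \<alpha>) / (to_ac \<theta> - z)) `
    ({y. poly (map_poly to_ac p) y = 0} \<times> {z. poly (map_poly to_ac q) z = 0})"
  have "map_poly to_ac p \<noteq> 0" "map_poly to_ac q \<noteq> 0"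
    using p(1) q(1) by (simp_all add: map_poly_eq_0_iff)
  then have "finite E"
    unfolding E_def by (intro finite_imageI finite_cartesian_product poly_roots_finite)
  then have "finite (to_ac -` E)"
    by (intro finite_vimageI inj_to_ac)
  moreover have "?Bad \<subseteq> to_ac -` E"
  proof (rule subsetI, rule ccontr)
    fix c assume "c \<in> ?Bad" and nE: "c \<notin> to_ac -` E"
    then obtain F where F: "is_subfield F" "c \<in> F" "\<alpha> + c * \<theta> \<in> F" "\<not> (\<alpha> \<in> F \<and> \<theta> \<in> F)"
      by blast
    note FR = subfield_subring[OF F(1)]
    \<comment> \<open>Substituting \<alpha> + c \<theta> - c X into \<open>p\<close> gives
      coefficients in \<open>F\<close>, and the value at \<theta> is p(\<alpha>) = 0.\<close>
    define h where "h = pcompose p [:\<alpha> + c * \<theta>, - c:]"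
    have h: "h \<in> polys_over F" "poly h \<theta> = 0"
      using F p FR by (auto simp: h_def polys_over_pCons polys_over_0 poly_pcompose
          intro!: polys_over_pcompose subring_uminus)
    obtain m where m: "m \<in> polys_over F" "m \<noteq> 0" "poly m \<theta> = 0"
      and dvd: "\<And>g. g \<in> polys_over F \<Longrightarrow> poly g \<theta> = 0 \<Longrightarrow> m dvd g"
      using minimal_polynomial_over_subfield[OF F(1) q(3)[OF FR] q(1,2)] by blast
    have "z = to_ac \<theta>" if z: "poly (map_poly to_ac m) z = 0" for z
    proof (rule ccontr)
      assume "z \<noteq> to_ac \<theta>"
      \<comment> \<open>A second root \<open>z\<close> of \<open>m\<close> is a root of
        \<open>h\<close>, so this argument of \<open>p\<close> is a root of \<open>p\<close>.
        Solving for \<open>c\<close> then puts \<open>c\<close> into \<open>E\<close>.\<close>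
      let ?y = "to_ac \<alpha> + to_ac c * to_ac \<theta> - to_ac c * z"
      have "poly (map_poly to_ac q) z = 0"
        using map_poly_to_ac_dvd_root[OF dvd[OF q(3)[OF FR] q(2)] z] .
      moreover have "poly (map_poly to_ac p) ?y = 0"
        using map_poly_to_ac_dvd_root[OF dvd[OF h] z]
        by (simp add: h_def map_poly_to_ac_pcompose map_poly_pCons poly_pcompose algebra_simps)
      moreover have "to_ac c = (?y - to_ac \<alpha>) / (to_ac \<theta> - z)"
        using \<open>z \<noteq> to_ac \<theta>\<close> by (simp add: field_simps)
      ultimately have "to_ac c \<in> E"
        unfolding E_def by (intro image_eqI[of _ _ "(?y, z)"]) auto
      with nE show False
        by simp
    qed
    then obtain a r where "a \<noteq> 0" "r > 0" "m = Polynomial.smult a ([:-\<theta>, 1:] ^ r)"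
      using unique_root_imp_linear_power[OF m(2,3)] by blast
    then have "\<theta> \<in> F"
      using linear_power_root_mem_subfield[OF F(1)] m(1) by blast
    moreover from this have "\<alpha> + c * \<theta> - c * \<theta> \<in> F"
      using F by (intro subring_diff subring_mult FR)
    ultimately show False
      using F(4) by simp
  qed
  ultimately show ?thesis
    by (rule rev_finite_subset)
qed

text \<open>The elements of \<open>B\<close> are absorbed one at a time. For a suitable
  \<open>k\<close>, every subfield containing \<beta> + d k b contains both \<beta> and b. Because
  the claim ranges over all subfields \<open>F\<close>, the induction hypothesis for \<beta> then
  applies to the same \<open>F\<close>. Every correction is a multiple of \<open>d\<close>, so the
  residue class of \<alpha> is preserved.\<close>

lemma ex_congruent_generating_finite_set:
  fixes R :: "'a::field_char_0 set"
  assumes R: "is_subring R" "R \<subseteq> ring_of_integers" and "d \<noteq> 0" "\<alpha> \<in> R"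
  shows "finite B \<Longrightarrow> B \<subseteq> R \<Longrightarrow> \<exists>\<gamma>\<in>R. \<forall>F. is_subfield F \<and> \<alpha> + of_int d * \<gamma> \<in> F \<longrightarrow> B \<subseteq> F"
proof (induction B rule: finite_induct)
  case empty
  show ?case
    using subring_zero[OF R(1)] by blast
next
  case (insert b B)
  then obtain \<gamma> where \<gamma>: "\<gamma> \<in> R"
    "\<And>F. is_subfield F \<Longrightarrow> \<alpha> + of_int d * \<gamma> \<in> F \<Longrightarrow> B \<subseteq> F"
    by auto
  have b: "b \<in> R"
    using insert.prems by simp
  let ?\<beta> = "\<alpha> + of_int d * \<gamma>"
  let ?Bad = "{c. \<exists>F. is_subfield F \<and> c \<in> F \<and> ?\<beta> + c * b \<in> F \<and> \<not> (?\<beta> \<in> F \<and> b \<in> F)}"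
  have "?\<beta> \<in> R"
    using assms \<gamma> by (intro subring_add subring_mult subring_of_int R)
  then have "finite ?Bad"
    using R(2) b by (intro finite_nonprimitive_combinations) (auto simp: ring_of_integers_def)
  moreover have "inj (\<lambda>k. of_int (d * k) :: 'a)"
    using \<open>d \<noteq> 0\<close> by (auto simp: inj_on_def)
  ultimately have "finite ((\<lambda>k. of_int (d * k) :: 'a) -` ?Bad)"
    by (rule finite_vimageI)
  \<comment> \<open>As \<open>d\<close> is nonzero, distinct \<open>k\<close> give distinct
    \<open>d * k\<close>. Only finitely many \<open>k\<close> are bad, and some integer is left
    over.\<close>
  from ex_new_if_finite[OF infinite_UNIV_int this]
  obtain k where "k \<notin> (\<lambda>k. of_int (d * k) :: 'a) -` ?Bad"
    by (rule exE)
  then have k: "of_int (d * k) \<notin> ?Bad"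
    by (simp only: vimage_eq not_False_eq_True)
  show ?case
  proof (intro bexI[of _ "\<gamma> + of_int k * b"] allI impI)
    fix F assume "is_subfield F \<and> \<alpha> + of_int d * (\<gamma> + of_int k * b) \<in> F"
    then have F: "is_subfield F" and "?\<beta> + of_int (d * k) * b \<in> F"
      by (auto simp: algebra_simps)
    \<comment> \<open>The condition \<open>c \<in> F\<close> in the exceptional set holds here
      because \<open>d * k\<close> is an integer.\<close>
    then have "?\<beta> \<in> F \<and> b \<in> F"
      using k subring_of_int[OF subfield_subring[OF F]] by blast
    with \<gamma>(2)[OF F] show "insert b B \<subseteq> F"
      by simp
  qed (use R \<gamma> b in \<open>auto intro: subring_add subring_mult subring_of_int\<close>)
qed

subsection \<open>Orders and denominators\<close>

text \<open>\<open>P d a\<close> is to be read as "\<open>d\<close> is a denominator of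
  \<open>a\<close>"; since multiples of denominators are denominators, products are common ones. The
  predicate is abstract because it serves both for rational coordinates and for polynomial
  coefficients relative to an order.\<close>

lemma ex_common_denominator:
  fixes P :: "int \<Rightarrow> 'b \<Rightarrow> bool"
  assumes "finite A" "\<And>a. a \<in> A \<Longrightarrow> \<exists>d>0. P d a"
    and mult: "\<And>d e a. P d a \<Longrightarrow> P (e * d) a"
  shows "\<exists>d>0. \<forall>a\<in>A. P d a"
  using assms(1,2)
proof (induction A rule: finite_induct)
  case (insert a A)
  then obtain d e where "d > 0" "\<forall>x\<in>A. P d x" "e > 0" "P e a"
    by (metis insert_iff)
  then have "\<forall>x\<in>insert a A. P (d * e) x"
    using mult[of d _ e] mult[of e _ d] by (auto simp: mult.commute)
  with \<open>d > 0\<close> \<open>e > 0\<close> show ?case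
    by (intro exI[of _ "d * e"]) simp
qed (auto intro: exI[of _ 1])

lemma ex_common_denominator_rat:
  fixes u :: "'b \<Rightarrow> rat"
  assumes "finite A"
  shows "\<exists>d>0. \<forall>a\<in>A. of_int d * u a \<in> \<int>"
proof (rule ex_common_denominator[OF assms])
  fix a
  obtain m n where mn: "u a = Rat.Fract m n" "n > 0"
    by (rule Rat_cases)
  have "of_int n * u a = of_int m"
    unfolding mn(1) Fract_of_int_quotient using mn(2) by simp
  then have "of_int n * u a \<in> \<int>"
    by (simp only: Ints_of_int)
  with mn(2) show "\<exists>d>0. of_int d * u a \<in> \<int>"
    by (intro exI[of _ n] conjI)
next
  fix d e a
  assume "of_int d * u a \<in> \<int>"
  with Ints_of_int have "of_int e * (of_int d * u a) \<in> \<int>"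
    by (rule Ints_mult)
  then show "of_int (e * d) * u a \<in> \<int>"
    by (simp only: of_int_mult mult.assoc)
qed

text \<open>Clearing denominators turns a rational relation into an integral one. This links the
  rank of an order, defined by \<int>-independence, with the degree of the field, a dimension over
  \<rat>.\<close>

lemma int_independent_imp_rat_independent:
  fixes B :: "'a::field_char_0 set"
  assumes "finite B" and ind: "int_mod.independent B"
  shows "rat_vs.independent B"
proof
  assume "rat_vs.dependent B"
  then obtain u v where v: "v \<in> B" "u v \<noteq> 0" and sum: "(\<Sum>b\<in>B. of_rat (u b) * b) = 0"
    using \<open>finite B\<close> by (auto simp: rat_vs.dependent_finite)
  obtain d where d: "d > 0" "\<forall>b\<in>B. of_int d * u b \<in> \<int>"
    using ex_common_denominator_rat[OF \<open>finite B\<close>] by blast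
  then obtain k where k: "\<And>b. b \<in> B \<Longrightarrow> of_int d * u b = of_int (k b)"
    unfolding Ints_def image_iff by metis
  have "of_int (k b) = (of_int d * of_rat (u b) :: 'a)" if "b \<in> B" for b
    using arg_cong[OF k[OF that], of "of_rat :: rat \<Rightarrow> 'a"] by (simp add: of_rat_mult)
  then have "(\<Sum>b\<in>B. of_int (k b) * b) = of_int d * (\<Sum>b\<in>B. of_rat (u b) * b)"
    by (simp add: sum_distrib_left mult.assoc)
  then have "k v = 0"
    using int_mod.independentD[OF ind \<open>finite B\<close> order_refl _ v(1)] sum by simp
  with k[OF v(1)] v(2) d(1) show False
    by simp
qed

text \<open>Maximal rank provides as many independent elements of \<open>R\<close> as the dimension
  of K. If they did not span K, one more element could be added, giving an independent set larger
  than the dimension.\<close>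

lemma order_ex_basis:
  fixes R :: "'a::field_char_0 set"
  assumes "number_field TYPE('a)" "is_order R"
  obtains B where "finite B" "B \<subseteq> R" "rat_vs.span B = UNIV"
proof -
  obtain B where B: "B \<subseteq> R" "int_mod.independent B" "finite B"
    "card B = rat_vs.dim (UNIV :: 'a set)"
    using assms(2) by (auto simp: is_order_def has_int_rank_def field_degree_def)
  obtain T :: "'a set" where T: "finite T" "rat_vs.span T = UNIV"
    using assms(1) by (auto simp: number_field_def)
  have ind: "rat_vs.independent B"
    using int_independent_imp_rat_independent B by blast
  have "x \<in> rat_vs.span B" for x
  proof (rule ccontr)
    assume x: "x \<notin> rat_vs.span B"
    then have ind': "rat_vs.independent (insert x B)"
      using ind by (rule rat_vs.independent_insertI)
    obtain C where C: "insert x B \<subseteq> C" "rat_vs.independent C" "UNIV \<subseteq> rat_vs.span C"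
      by (rule rat_vs.maximal_independent_subset_extend[OF subset_UNIV ind'])
    \<comment> \<open>\<open>dim\<close> is the cardinality of a basis such as \<open>C\<close>.
      Comparing it with \<open>insert x B\<close> requires \<open>C\<close> to be finite, which
      follows from the finite spanning set \<open>T\<close>.\<close>
    then have "finite C"
      using rat_vs.independent_span_bound[OF T(1) C(2)] T(2) by simp
    then have "card (insert x B) \<le> rat_vs.dim (UNIV :: 'a set)"
      using card_mono[OF _ C(1)] rat_vs.basis_card_eq_dim[OF subset_UNIV C(3,2)] by simp
    moreover have "x \<notin> B"
      using x rat_vs.span_base[of x B] by blast
    ultimately show False
      using B by simp
  qed
  with B(1,3) show thesis
    by (intro that) auto
qed

lemma rat_span_UNIV_expand:
  assumes "finite B" "rat_vs.span B = UNIV"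
  obtains u where "x = (\<Sum>b\<in>B. of_rat (u b) * b)"
proof -
  have "x \<in> range (\<lambda>u. \<Sum>b\<in>B. of_rat (u b) * b)"
    using rat_vs.span_finite[OF assms(1)] assms(2) by simp
  then show thesis
    by (rule rangeE) (rule that)
qed

text \<open>A common denominator of the coordinates of \<open>x\<close> in a rational spanning set
  inside \<open>R\<close> turns \<open>x\<close> into an integral combination of elements of
  \<open>R\<close>.\<close>

lemma order_ex_denominator:
  fixes R :: "'a::field_char_0 set"
  assumes "number_field TYPE('a)" "is_order R"
  shows "\<exists>d>0. of_int d * x \<in> R"
proof -
  have R: "is_subring R"
    using assms(2) by (simp add: is_order_def)
  obtain B where B: "finite B" "B \<subseteq> R" "rat_vs.span B = UNIV"
    using order_ex_basis[OF assms] .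
  obtain u where u: "x = (\<Sum>b\<in>B. of_rat (u b) * b)"
    using rat_span_UNIV_expand[OF B(1,3)] .
  obtain d where d: "d > 0" "\<forall>b\<in>B. of_int d * u b \<in> \<int>"
    using ex_common_denominator_rat[OF \<open>finite B\<close>] by blast
  have "of_int d * (of_rat (u b) * b) \<in> R" if "b \<in> B" for b
  proof -
    obtain k where k: "of_int d * u b = of_int k"
      using d(2) \<open>b \<in> B\<close> by (auto elim: Ints_cases)
    have "of_int d * of_rat (u b) = (of_int k :: 'a)"
      using arg_cong[OF k, of "of_rat :: rat \<Rightarrow> 'a"] by (simp add: of_rat_mult)
    then have "of_int d * (of_rat (u b) * b) = of_int k * b"
      by (simp flip: mult.assoc)
    also have "\<dots> \<in> R"
      using B(2) \<open>b \<in> B\<close> by (auto intro!: subring_mult subring_of_int R)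
    finally show ?thesis .
  qed
  then have "of_int d * x \<in> R"
    by (auto simp: u sum_distrib_left intro: subring_sum R)
  with d(1) show ?thesis
    by blast
qed

text \<open>A subfield containing a spanning set of K over \<rat> also contains \<rat>, hence is K.
  It suffices to apply the previous construction to a finite spanning set inside
  \<open>R\<close>.\<close>

lemma order_ex_congruent_generator:
  fixes R :: "'a::field_char_0 set"
  assumes "number_field TYPE('a)" "is_order R" "d \<noteq> 0" "\<alpha> \<in> R"
  shows "\<exists>\<gamma>\<in>R. \<alpha> + of_int d * \<gamma> \<in> field_generators R"
proof -
  have R: "is_subring R" "R \<subseteq> ring_of_integers"
    using assms(2) by (simp_all add: is_order_def)
  obtain B where B: "finite B" "B \<subseteq> R" "rat_vs.span B = UNIV"
    using order_ex_basis[OF assms(1,2)] .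
  obtain \<gamma> where \<gamma>: "\<gamma> \<in> R" "\<And>F. is_subfield F \<Longrightarrow> \<alpha> + of_int d * \<gamma> \<in> F \<Longrightarrow> B \<subseteq> F"
    using ex_congruent_generating_finite_set[OF R assms(3,4) B(1,2)] by blast
  have "x \<in> F" if F: "is_subfield F" "\<alpha> + of_int d * \<gamma> \<in> F" for F and x :: 'a
  proof -
    obtain u where "x = (\<Sum>b\<in>B. of_rat (u b) * b)"
      using rat_span_UNIV_expand[OF B(1,3)] .
    then show ?thesis
      using \<gamma>(2)[OF F] subfield_subring[OF F(1)]
      by (auto intro!: subring_sum subring_mult subfield_of_rat F(1))
  qed
  then have "rat_adjoin (\<alpha> + of_int d * \<gamma>) = UNIV"
    by (auto simp: rat_adjoin_def)
  moreover have "\<alpha> + of_int d * \<gamma> \<in> R"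
    using assms(4) \<gamma>(1) by (intro subring_add subring_mult subring_of_int R)
  ultimately show ?thesis
    using \<gamma>(1) by (auto simp: field_generators_def)
qed

section \<open>Quotient field and polynomial density of the generators\<close>

lemma order_has_quotient_field_UNIV:
  fixes R :: "'a::field_char_0 set"
  assumes "number_field TYPE('a)" "is_order R"
  shows "has_quotient_field_UNIV R"
proof -
  have R: "is_subring R"
    using assms(2) by (simp add: is_order_def)
  have "\<exists>a\<in>R. \<exists>b\<in>R. b \<noteq> 0 \<and> x = a / b" for x
  proof -
    obtain d where "d > 0" "of_int d * x \<in> R"
      using order_ex_denominator[OF assms] by blast
    then show ?thesis
      using subring_of_int[OF R, of d]
      by (intro bexI[of _ "of_int d * x"] bexI[of _ "of_int d"]) auto
  qed
  with R show ?thesis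
    by (simp add: has_quotient_field_UNIV_def)
qed

lemma order_int_valued_on_generators:
  fixes R :: "'a::field_char_0 set"
  assumes "number_field TYPE('a)" "is_order R"
    and f: "f \<in> int_valued_on (field_generators R) R"
  shows "f \<in> int_valued R"
proof -
  have R: "is_subring R"
    using assms(2) by (simp add: is_order_def)
  \<comment> \<open>Only coefficients up to the degree need a denominator; the others are 0.\<close>
  have "\<exists>d>0. \<forall>i\<in>{..Polynomial.degree f}. of_int d * Polynomial.coeff f i \<in> R"
  proof (rule ex_common_denominator[OF finite_atMost])
    show "\<exists>e>0. of_int e * Polynomial.coeff f i \<in> R" for i
      by (rule order_ex_denominator[OF assms(1,2)])
    show "of_int (e' * e) * Polynomial.coeff f i \<in> R"
      if "of_int e * Polynomial.coeff f i \<in> R" for e e' i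
      using subring_mult[OF R subring_of_int[OF R] that] by (simp only: of_int_mult mult.assoc)
  qed
  then obtain d where "d > 0"
    and d: "\<And>i. i \<le> Polynomial.degree f \<Longrightarrow> of_int d * Polynomial.coeff f i \<in> R"
    by auto
  have df: "Polynomial.smult (of_int d) f \<in> polys_over R"
    unfolding polys_over_def
  proof safe
    fix i show "Polynomial.coeff (Polynomial.smult (of_int d) f) i \<in> R"
      using d[of i] subring_zero[OF R] coeff_eq_0[of f i]
      by (cases "i \<le> Polynomial.degree f") auto
  qed
  have "poly f \<alpha> \<in> R" if \<alpha>: "\<alpha> \<in> R" for \<alpha>
  proof -
    obtain \<gamma> where \<gamma>: "\<gamma> \<in> R" "\<alpha> + of_int d * \<gamma> \<in> field_generators R"
      using order_ex_congruent_generator[OF assms(1,2) _ \<alpha>, of d] \<open>d > 0\<close> by auto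
    let ?\<beta> = "\<alpha> + of_int d * \<gamma>"
    have "?\<beta> \<in> R" "poly f ?\<beta> \<in> R"
      using \<gamma>(2) f by (auto simp: field_generators_def int_valued_on_def)
    \<comment> \<open>The factorization is applied to d f, which lies in R[X]. Since \<beta> -
      \<alpha> = d \<gamma>, the factor \<open>d\<close> cancels and leaves f(\<alpha>) = f(\<beta>)
      - \<gamma> r.\<close>
    obtain r where r: "r \<in> R" "of_int d * poly f ?\<beta> - of_int d * poly f \<alpha> = (?\<beta> - \<alpha>) * r"
      using poly_diff_factor[OF R \<open>?\<beta> \<in> R\<close> \<alpha> df] by auto
    then have "of_int d * poly f \<alpha> = of_int d * (poly f ?\<beta> - \<gamma> * r)"
      by (simp add: algebra_simps)
    then have "poly f \<alpha> = poly f ?\<beta> - \<gamma> * r"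
      using \<open>d > 0\<close> by simp
    then show ?thesis
      using \<open>poly f ?\<beta> \<in> R\<close> r(1) \<gamma>(1) by (simp add: subring_diff subring_mult R)
  qed
  then show ?thesis
    by (auto simp: int_valued_on_def)
qed

theorem theorem2p1:
  fixes R :: "'a::field_char_0 set" and n :: nat
  assumes "number_field TYPE('a)"
    and "field_degree TYPE('a) = n"
    and "is_order R"
  shows "int_valued_on (field_generators R) R = int_valued R \<and>
         polynomially_dense (field_generators R) R"
proof -
  have sub: "field_generators R \<subseteq> R"
    by (auto simp: field_generators_def)
  then have "int_valued R \<subseteq> int_valued_on (field_generators R) R"
    by (auto simp: int_valued_on_def)
  then have "int_valued_on (field_generators R) R = int_valued R"
    using order_int_valued_on_generators[OF assms(1,3)] by blast
  with sub show ?thesis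
    using order_has_quotient_field_UNIV[OF assms(1,3)] by (simp add: polynomially_dense_def)
qed

end
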